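(* Let $n,m\ge1$, let $B_0,B_1,\dots,B_m$ be $n\times n$ complex matrices, let $\alpha_1,\dots,\alpha_m$ be complex numbers with $|\alpha_1|<|\alpha_2|<\cdots<|\alpha_m|$, and let $\|\cdot\|$ be any induced matrix norm on $M_n(\mathbb{C})$. Let $$q(x)=x-\|B_0\|-\frac{\|B_1\|}{x-|\alpha_1|}-\cdots-\frac{\|B_m\|}{x-|\alpha_m|},$$ and let $R$ be the largest real root of $q(x)$. Then $$R\le\frac12\left(|\alpha_m|+\|B_0\|+\sqrt{(|\alpha_m|-\|B_0\|)^2+4k}\right),$$ where $k=\max\left\{m,\ \sum_{i=1}^m\|B_i\|^2\right\}$.
   Context: An induced matrix norm on $M_n(\mathbb{C})$ is the operator norm corresponding to some norm on $\mathbb{C}^n$. *)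

theory Defs
  imports "HOL-Analysis.Analysis"
begin

definition vector_norm :: "(complex ^ 'n \<Rightarrow> real) \<Rightarrow> bool" where
  "vector_norm N \<longleftrightarrow>
     (\<forall>x. 0 \<le> N x) \<and>
     (\<forall>x. N x = 0 \<longleftrightarrow> x = 0) \<and>
     (\<forall>c x. N (c *s x) = cmod c * N x) \<and>
     (\<forall>x y. N (x + y) \<le> N x + N y)"

text \<open>The library's \<^const>\<open>onorm\<close> is tied to the norm of the type class (on
  \<open>complex ^ 'n\<close>, the Euclidean one), whereas here the norm on the space is arbitrary.\<close>

definition operator_norm :: "(complex ^ 'n \<Rightarrow> real) \<Rightarrow> complex ^ 'n ^ 'n \<Rightarrow> real" where
  "operator_norm N A = (SUP x\<in>{x. x \<noteq> 0}. N (A *v x) / N x)"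

definition induced_matrix_norm :: "(complex ^ 'n ^ 'n \<Rightarrow> real) \<Rightarrow> bool" where
  "induced_matrix_norm M \<longleftrightarrow> (\<exists>N. vector_norm N \<and> M = operator_norm N)"

definition q_fun ::
  "(complex ^ 'n ^ 'n \<Rightarrow> real) \<Rightarrow> nat \<Rightarrow> (nat \<Rightarrow> complex ^ 'n ^ 'n) \<Rightarrow> (nat \<Rightarrow> complex) \<Rightarrow> real \<Rightarrow> real"
where
  "q_fun M m B \<alpha> x = x - M (B 0) - (\<Sum>i=1..m. M (B i) / (x - cmod (\<alpha> i)))"

text \<open>Roots of the rational function \<open>q\<close>. Since division by zero yields zero in HOL, \<open>q_fun\<close> has a
  meaningless value at a pole, so poles must be excluded explicitly. A point \<open>cmod (\<alpha> i)\<close> is a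
  pole only if the numerator \<open>M (B i)\<close> is nonzero; if it is zero, that summand is the zero rational
  function, in accordance with the value of \<open>q_fun\<close>. Hence a largest root always exists, also when
  some of the matrices \<open>B i\<close> vanish.\<close>

definition q_root ::
  "(complex ^ 'n ^ 'n \<Rightarrow> real) \<Rightarrow> nat \<Rightarrow> (nat \<Rightarrow> complex ^ 'n ^ 'n) \<Rightarrow> (nat \<Rightarrow> complex) \<Rightarrow> real \<Rightarrow> bool"
where
  "q_root M m B \<alpha> x \<longleftrightarrow>
     (\<forall>i\<in>{1..m}. M (B i) \<noteq> 0 \<longrightarrow> x \<noteq> cmod (\<alpha> i)) \<and> q_fun M m B \<alpha> x = 0"

end

theory Submission
  imports Defs
begin

text \<open>Write \<open>w i\<close> for the norms of the \<open>B i\<close>, \<open>c\<close> for that of \<open>B 0\<close> and \<open>a\<close> for the largest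
  modulus \<open>\<bar>\<alpha> m\<bar>\<close>. A root \<open>x\<close> that exceeds \<open>a\<close> has \<open>x - a \<le> x - \<bar>\<alpha> i\<bar>\<close> for all \<open>i\<close>, so that
  \<open>(x - c) * (x - a) \<le> (\<Sum>i. w i)\<close>; since \<open>2 * w i \<le> 1 + (w i)\<^sup>2\<close>, the right-hand side is at most
  \<open>(m + (\<Sum>i. (w i)\<^sup>2)) / 2 \<le> k\<close>. Hence \<open>x\<close> does not exceed the larger zero of
  \<open>(x - c) * (x - a) - k\<close>, which is the asserted bound. That zero is at least \<open>a\<close>, so roots not
  exceeding \<open>a\<close> satisfy the bound too (\<open>secular_root_le\<close>).

  Every root thus obeys the bound, and what remains is that the greatest root is indeed a root,
  which means that a greatest one must exist (\<open>ex_greatest_secular_root\<close>): beyond its last genuine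
  pole, \<open>q\<close> increases strictly from \<open>-\<infinity>\<close> to \<open>\<infinity>\<close>.

  Both arguments use that the \<open>w i\<close> are nonnegative. As an operator norm is a supremum of reals,
  this requires the supremum to be taken over a bounded set, i.e. that every matrix is bounded with
  respect to an arbitrary norm (\<open>operator_norm_nonneg\<close>).\<close>

section \<open>Operator norms for an arbitrary vector norm\<close>

lemma vector_norm_sum_le:
  assumes "vector_norm N"
  shows "N (\<Sum>i\<in>I. f i) \<le> (\<Sum>i\<in>I. N (f i))"
proof -
  have zero: "N 0 = 0" using assms by (simp add: vector_norm_def)
  show ?thesis
  proof (induction I rule: infinite_finite_induct)
    case (insert i I)
    have "N (f i + (\<Sum>i\<in>I. f i)) \<le> N (f i) + N (\<Sum>i\<in>I. f i)"
      using assms unfolding vector_norm_def by blast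
    then show ?case using insert by simp
  qed (use zero in simp_all)
qed

text \<open>Expanding \<open>A *v x\<close> in the columns of \<open>A\<close> bounds it by the Euclidean norm of \<open>x\<close>. With the
  identity matrix this says that \<open>N\<close> is dominated by the Euclidean norm.\<close>

lemma vector_norm_matrix_vector_le:
  fixes A :: "complex ^ 'n ^ 'n"
  assumes "vector_norm N"
  shows "N (A *v x) \<le> (\<Sum>i\<in>UNIV. N (column i A)) * norm x"
proof -
  have "N (A *v x) = N (\<Sum>i\<in>UNIV. x $ i *s column i A)"
    by (simp add: matrix_mult_sum)
  also have "\<dots> \<le> (\<Sum>i\<in>UNIV. N (x $ i *s column i A))"
    by (rule vector_norm_sum_le[OF assms])
  also have "\<dots> = (\<Sum>i\<in>UNIV. cmod (x $ i) * N (column i A))"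
    using assms by (simp add: vector_norm_def)
  also have "\<dots> \<le> (\<Sum>i\<in>UNIV. norm x * N (column i A))"
    using assms by (intro sum_mono mult_right_mono Finite_Cartesian_Product.norm_nth_le)
      (auto simp: vector_norm_def)
  finally show ?thesis by (simp add: sum_distrib_left mult.commute)
qed

lemma continuous_on_vector_norm:
  fixes N :: "complex ^ 'n \<Rightarrow> real"
  assumes N: "vector_norm N"
  shows "continuous_on S N"
proof -
  define K where "K = (\<Sum>i\<in>UNIV. N (column i (mat 1 :: complex ^ 'n ^ 'n)))"
  have K0: "0 \<le> K"
    using N unfolding K_def vector_norm_def by (auto intro: sum_nonneg)
  have le: "N x - N y \<le> K * norm (x - y)" for x y
  proof -
    have "N ((x - y) + y) \<le> N (x - y) + N y"
      using N unfolding vector_norm_def by blast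
    moreover have "N (x - y) \<le> K * norm (x - y)"
      using vector_norm_matrix_vector_le[OF N, of "mat 1" "x - y"] by (simp add: K_def)
    ultimately show ?thesis by simp
  qed
  have "K-lipschitz_on S N"
  proof (rule lipschitz_onI)
    fix x y
    show "dist (N x) (N y) \<le> K * dist x y"
      using le[of x y] le[of y x] by (simp add: dist_norm norm_minus_commute abs_le_iff)
  qed (rule K0)
  then show ?thesis by (rule lipschitz_on_continuous_on)
qed

text \<open>The continuous function \<open>N\<close> attains a positive minimum on the compact Euclidean unit sphere;
  homogeneity extends the resulting bound to all vectors.\<close>

lemma vector_norm_ge_norm:
  fixes N :: "complex ^ 'n \<Rightarrow> real"
  assumes N: "vector_norm N"
  obtains d where "0 < d" "\<And>x. d * norm x \<le> N x"
proof -
  have "sphere (0 :: complex ^ 'n) 1 \<noteq> {}" by simp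
  then obtain u where u: "u \<in> sphere 0 1" and min: "\<And>y. y \<in> sphere 0 1 \<Longrightarrow> N u \<le> N y"
    using continuous_attains_inf[OF compact_sphere _ continuous_on_vector_norm[OF N]] by blast
  have "u \<noteq> 0" using u by auto
  then have "0 < N u" using N unfolding vector_norm_def by (metis less_eq_real_def)
  moreover have "N u * norm x \<le> N x" for x
  proof (cases "x = 0")
    case True
    then show ?thesis using N by (simp add: vector_norm_def)
  next
    case False
    define y where "y = complex_of_real (1 / norm x) *s x"
    have "y = (1 / norm x) *\<^sub>R x"
      by (simp add: y_def vec_eq_iff scaleR_conv_of_real[where 'a = complex])
    then have "y \<in> sphere 0 1" using False by simp
    then have "N u \<le> N y" by (rule min)
    also have "N y = cmod (complex_of_real (1 / norm x)) * N x"
      using N unfolding y_def vector_norm_def by blast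
    also have "\<dots> = N x / norm x" by (simp add: norm_divide)
    finally show ?thesis using False by (simp add: pos_le_divide_eq)
  qed
  ultimately show thesis by (rule that)
qed

lemma operator_norm_nonneg:
  fixes A :: "complex ^ 'n ^ 'n"
  assumes N: "vector_norm N"
  shows "0 \<le> operator_norm N A"
proof -
  obtain d where d: "0 < d" "\<And>x. d * norm x \<le> N x"
    using vector_norm_ge_norm[OF N] by blast
  have N0: "0 \<le> N x" "N x = 0 \<longleftrightarrow> x = 0" for x
    using N by (auto simp: vector_norm_def)
  define K where "K = (\<Sum>i\<in>UNIV. N (column i A))"
  have K0: "0 \<le> K" unfolding K_def by (intro sum_nonneg N0)
  have bound: "N (A *v x) / N x \<le> K / d" if "x \<noteq> 0" for x
  proof -
    have "N (A *v x) \<le> K * norm x"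
      unfolding K_def by (rule vector_norm_matrix_vector_le[OF N])
    also have "\<dots> \<le> K * (N x / d)"
      using d by (intro mult_left_mono K0) (simp add: pos_le_divide_eq mult.commute)
    finally have "N (A *v x) \<le> K / d * N x" by simp
    moreover have "0 < N x" using N0[of x] that by linarith
    ultimately show ?thesis by (simp add: pos_divide_le_eq)
  qed
  define e :: "complex ^ 'n" where "e = axis undefined 1"
  have e: "e \<noteq> 0" by (simp add: e_def axis_eq_0_iff)
  have "0 \<le> N (A *v e) / N e" by (simp add: N0)
  also have "\<dots> \<le> operator_norm N A"
    unfolding operator_norm_def
    by (rule cSUP_upper) (use e bound in \<open>auto intro!: bdd_aboveI2\<close>)
  finally show ?thesis .
qed

section \<open>Roots of secular functions\<close>

text \<open>Let \<open>p\<close> be the largest pole whose weight does not vanish. The function is continuous and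
  strictly increasing to the right of \<open>p\<close> and changes sign there, so it has a unique root beyond \<open>p\<close>,
  and any other root is smaller than \<open>p\<close>. If all weights vanish, the only root is \<open>c\<close>.\<close>

lemma ex_greatest_secular_root:
  fixes a w :: "'i \<Rightarrow> real" and c :: real and I :: "'i set"
  defines "f \<equiv> \<lambda>x. x - c - (\<Sum>i\<in>I. w i / (x - a i))"
  defines "is_root \<equiv> \<lambda>x. (\<forall>i\<in>I. w i \<noteq> 0 \<longrightarrow> x \<noteq> a i) \<and> f x = 0"
  assumes fin: "finite I" and w0: "\<And>i. i \<in> I \<Longrightarrow> 0 \<le> w i"
  obtains r where "is_root r" "\<And>x. is_root x \<Longrightarrow> x \<le> r"
proof (cases "\<forall>i\<in>I. w i = 0")
  case True
  then have "is_root x \<longleftrightarrow> x = c" for x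
    by (auto simp: is_root_def f_def)
  then show thesis using that[of c] by simp
next
  case False
  define S where "S = {i \<in> I. w i \<noteq> 0}"
  have S: "finite (a ` S)" "a ` S \<noteq> {}" using fin False by (auto simp: S_def)
  define p where "p = Max (a ` S)"
  have le_p: "a i \<le> p" if "i \<in> I" "w i \<noteq> 0" for i
    using that S unfolding p_def by (auto simp: S_def)
  obtain j where j: "j \<in> I" "w j \<noteq> 0" "a j = p"
    using Max_in[OF S] by (auto simp: S_def p_def)
  have wj: "0 < w j" using w0[of j] j by simp
  define W where "W = (\<Sum>i\<in>I. w i)"

  have incr: "f x < f y" if xy: "p < x" "x < y" for x y
  proof -
    have "w i / (y - a i) \<le> w i / (x - a i)" if i: "i \<in> I" for i
    proof (cases "w i = 0")
      case False
      then show ?thesis using le_p[OF i] w0[OF i] xy by (intro divide_left_mono) auto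
    qed simp
    then have "(\<Sum>i\<in>I. w i / (y - a i)) \<le> (\<Sum>i\<in>I. w i / (x - a i))" by (rule sum_mono)
    then show ?thesis using xy by (simp add: f_def)
  qed

  \<comment> \<open>The step \<open>d \<le> 1\<close> beyond the pole is so small that the pole's summand, which equals
    \<open>\<bar>p - c\<bar> + 1 + w j\<close>, outweighs the linear part.\<close>
  define d where "d = w j / (\<bar>p - c\<bar> + 1 + w j)"
  have d: "0 < d" "d \<le> 1" "w j / d = \<bar>p - c\<bar> + 1 + w j"
    using wj by (auto simp: d_def field_simps)
  have lower: "f (p + d) \<le> 0"
  proof -
    have "w j / (p + d - a j) \<le> (\<Sum>i\<in>I. w i / (p + d - a i))"
    proof (rule member_le_sum)
      fix i assume "i \<in> I - {j}"
      then show "0 \<le> w i / (p + d - a i)"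
        using le_p[of i] w0[of i] d by (cases "w i = 0") auto
    qed (use j fin in auto)
    then show ?thesis using d wj by (simp add: f_def j)
  qed

  \<comment> \<open>At a point that exceeds every genuine pole by at least \<open>1\<close>, the fractions sum to at most \<open>W\<close>.\<close>
  define X where "X = p + 1 + \<bar>c - p\<bar> + W"
  have W0: "0 \<le> W" unfolding W_def by (intro sum_nonneg w0)
  have upper: "0 \<le> f X"
  proof -
    have "w i / (X - a i) \<le> w i" if i: "i \<in> I" for i
    proof (cases "w i = 0")
      case False
      then have "1 \<le> X - a i" using le_p[OF i] W0 by (simp add: X_def)
      then show ?thesis using w0[OF i] by (simp add: pos_divide_le_eq mult_le_cancel_left1)
    qed simp
    then have "(\<Sum>i\<in>I. w i / (X - a i)) \<le> W" unfolding W_def by (rule sum_mono)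
    then show ?thesis by (simp add: f_def X_def)
  qed

  have cont: "continuous_on {p + d..X} f"
  proof -
    have "continuous_on {p + d..X} (\<lambda>x. w i / (x - a i))" if i: "i \<in> I" for i
    proof (cases "w i = 0")
      case False
      then show ?thesis using le_p[OF i] d by (intro continuous_intros) auto
    qed simp
    then show ?thesis
      unfolding f_def
      by (intro continuous_on_diff continuous_on_sum continuous_on_id continuous_on_const)
  qed
  have "p + d \<le> X" using d W0 by (simp add: X_def)
  then obtain r where r: "p + d \<le> r" "f r = 0"
    using IVT'[OF lower upper _ cont] by blast
  show thesis
  proof (rule that)
    show "is_root r" using r d le_p by (fastforce simp: is_root_def)
    show "x \<le> r" if "is_root x" for x
    proof (rule ccontr)
      assume "\<not> x \<le> r"
      then have "f r < f x" using r d by (intro incr) auto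
      then show False using that r by (simp add: is_root_def)
    qed
  qed
qed

text \<open>The bound is the larger zero of \<open>(x - c) * (x - A) - k\<close>, and it is at least \<open>A\<close>; only roots
  beyond \<open>A\<close> need an argument, and for those replacing each \<open>a i\<close> by \<open>A\<close> cannot make a
  fraction smaller.\<close>

lemma secular_root_le:
  fixes a w :: "'i \<Rightarrow> real" and c x A k :: real
  assumes root: "x - c - (\<Sum>i\<in>I. w i / (x - a i)) = 0"
    and w0: "\<And>i. i \<in> I \<Longrightarrow> 0 \<le> w i"
    and aA: "\<And>i. i \<in> I \<Longrightarrow> a i \<le> A"
    and k: "real (card I) \<le> k" "(\<Sum>i\<in>I. (w i)\<^sup>2) \<le> k"
  shows "x \<le> 1 / 2 * (A + c + sqrt ((A - c)\<^sup>2 + 4 * k))"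
proof (cases "x \<le> A")
  case True
  have "0 \<le> k" using k(1) by linarith
  then have "A - c \<le> sqrt ((A - c)\<^sup>2 + 4 * k)" by (intro real_le_rsqrt) simp
  then show ?thesis using True by simp
next
  case False
  have "x - c = (\<Sum>i\<in>I. w i / (x - a i))" using root by simp
  also have "\<dots> \<le> (\<Sum>i\<in>I. w i / (x - A))"
  proof (rule sum_mono)
    fix i assume i: "i \<in> I"
    then show "w i / (x - a i) \<le> w i / (x - A)"
      using w0[OF i] aA[OF i] False by (intro divide_left_mono) auto
  qed
  also have "\<dots> = (\<Sum>i\<in>I. w i) / (x - A)" by (simp add: sum_divide_distrib)
  finally have "(x - c) * (x - A) \<le> (\<Sum>i\<in>I. w i)"
    using False by (simp add: pos_le_divide_eq)
  also have "\<dots> \<le> (\<Sum>i\<in>I. (1 + (w i)\<^sup>2) / 2)"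
  proof (rule sum_mono)
    fix i
    have "0 \<le> (w i - 1)\<^sup>2" by simp
    then show "w i \<le> (1 + (w i)\<^sup>2) / 2" by (simp add: power2_eq_square algebra_simps)
  qed
  also have "\<dots> = (real (card I) + (\<Sum>i\<in>I. (w i)\<^sup>2)) / 2"
    by (simp add: sum.distrib flip: sum_divide_distrib)
  also have "\<dots> \<le> k" using k by simp
  finally have "(2 * x - A - c)\<^sup>2 \<le> (A - c)\<^sup>2 + 4 * k"
    by (simp add: power2_eq_square algebra_simps)
  then have "2 * x - A - c \<le> sqrt ((A - c)\<^sup>2 + 4 * k)" by (rule real_le_rsqrt)
  then show ?thesis by simp
qed

section \<open>The bound for the largest root\<close>

theorem theorem2p12:
  fixes mnorm :: "complex ^ 'n ^ 'n \<Rightarrow> real"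
    and m :: nat
    and B :: "nat \<Rightarrow> complex ^ 'n ^ 'n"
    and \<alpha> :: "nat \<Rightarrow> complex"
    and R k :: real
  assumes "m \<ge> 1"
    and "strict_mono_on {1..m} (\<lambda>i. cmod (\<alpha> i))"
    and "induced_matrix_norm mnorm"
    and "R = (GREATEST x. q_root mnorm m B \<alpha> x)"
    and "k = max (real m) (\<Sum>i=1..m. (mnorm (B i))\<^sup>2)"
  shows "R \<le> 1 / 2 * (cmod (\<alpha> m) + mnorm (B 0)
           + sqrt ((cmod (\<alpha> m) - mnorm (B 0))\<^sup>2 + 4 * k))"
proof -
  have nonneg: "0 \<le> mnorm A" for A
    using assms(3) operator_norm_nonneg unfolding induced_matrix_norm_def by blast
  obtain r where r: "q_root mnorm m B \<alpha> r" "\<And>x. q_root mnorm m B \<alpha> x \<Longrightarrow> x \<le> r"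
    using ex_greatest_secular_root[of "{1..m}" "\<lambda>i. mnorm (B i)" "\<lambda>i. cmod (\<alpha> i)" "mnorm (B 0)"]
      nonneg unfolding q_root_def q_fun_def by blast
  have "R = r" unfolding assms(4) using r by (rule Greatest_equality)
  then have "R - mnorm (B 0) - (\<Sum>i\<in>{1..m}. mnorm (B i) / (R - cmod (\<alpha> i))) = 0"
    using r(1) by (simp add: q_root_def q_fun_def)
  then show ?thesis
  proof (rule secular_root_le)
    fix i assume "i \<in> {1..m}"
    then show "cmod (\<alpha> i) \<le> cmod (\<alpha> m)"
      using strict_mono_on_leD[OF assms(2), of i m] by simp
  qed (simp_all add: nonneg assms(5))
qed

end
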